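(* Let $z=z(q)$ be a conformal transformation, with inverse mapping $q=q(z)$. Let $\omega$ be the complex curvature coefficient of the conformal net of $z=z(q)$, and let $\widetilde\omega$ be the complex curvature coefficient of the dual conformal net, i.e. the conformal net associated with the inverse mapping $q=q(z)$. Then the derivative of the conformal transformation satisfies $$z_q=-\overline{\left(\frac{\widetilde\omega}{\omega}\right)}.$$
   Context: Write $q=q^1+iq^2$ and $z=z^1+iz^2$ with real $q^j,z^j$, and $z_q=dz/dq$, $q_z=dq/dz$. The bar denotes complex conjugation, and $\omega$ (a function of $q$) and $\widetilde\omega$ (a function of $z$) are compared at corresponding points $z=z(q)$. The conformal net of $z=z(q)$ has conformal factor $H=|z_q|>0$, with metric $H^2\bigl((dq^1)^2+(dq^2)^2\bigr)$ in the coordinates $(q^1,q^2)$. With the orthonormal coframe $\theta^1=H\,dq^1$, $\theta^2=H\,dq^2$, the connection form is $\omega^1_{\;2}=\omega^1_{\;21}\theta^1+\omega^1_{\;22}\theta^2$, where $$\omega^1_{\;21}=\frac{H_{q^2}}{H^2},\qquad \omega^1_{\;22}=-\frac{H_{q^1}}{H^2},$$ and the complex curvature coefficient is defined by $\omega=-\bigl(\omega^1_{\;21}-i\,\omega^1_{\;22}\bigr)$. The dual conformal net, associated with the inverse mapping $q=q(z)$, has conformal factor $\widetilde H=|q_z|=H^{-1}$ at corresponding points, with metric $\widetilde H^2\bigl((dz^1)^2+(dz^2)^2\bigr)$ in the coordinates $(z^1,z^2)$. Its complex curvature coefficient is defined in the same way: $\widetilde\omega=-\bigl(\widetilde\omega^1_{\;21}-i\,\widetilde\omega^1_{\;22}\bigr)$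 with $\widetilde\omega^1_{\;21}=\widetilde H_{z^2}/\widetilde H^2$ and $\widetilde\omega^1_{\;22}=-\widetilde H_{z^1}/\widetilde H^2$. *)

theory Defs
  imports "HOL-Complex_Analysis.Complex_Analysis"
begin

text \<open>
  The plane with coordinates \<open>(q\<^sup>1, q\<^sup>2)\<close> is identified with the complex numbers by
  \<open>q = q\<^sup>1 + \<i> q\<^sup>2\<close>. A conformal transformation is orientation preserving (it has a complex
  derivative, which does not vanish) and, having an inverse mapping, injective.
\<close>

definition conformal_transformation :: "(complex \<Rightarrow> complex) \<Rightarrow> complex set \<Rightarrow> complex set \<Rightarrow> bool"
  where "conformal_transformation f U V \<longleftrightarrow>
    open U \<and> f holomorphic_on U \<and> (\<forall>p\<in>U. deriv f p \<noteq> 0) \<and> bij_betw f U V"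

definition partial1 :: "(complex \<Rightarrow> real) \<Rightarrow> complex \<Rightarrow> real"
  where "partial1 h p = deriv (\<lambda>t::real. h (Complex t (Im p))) (Re p)"

definition partial2 :: "(complex \<Rightarrow> real) \<Rightarrow> complex \<Rightarrow> real"
  where "partial2 h p = deriv (\<lambda>t::real. h (Complex (Re p) t)) (Im p)"

definition conformal_factor :: "(complex \<Rightarrow> complex) \<Rightarrow> complex \<Rightarrow> real"
  where "conformal_factor f p = cmod (deriv f p)"

text \<open>
  For the metric \<open>H\<^sup>2 ((dq\<^sup>1)\<^sup>2 + (dq\<^sup>2)\<^sup>2)\<close>, the following are the coefficients of the connection
  form \<open>\<omega>\<^sup>1\<^sub>2\<close> in the orthonormal coframe \<open>\<theta>\<^sup>1 = H dq\<^sup>1\<close>, \<open>\<theta>\<^sup>2 = H dq\<^sup>2\<close>.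
\<close>

definition connection_coeff1 :: "(complex \<Rightarrow> real) \<Rightarrow> complex \<Rightarrow> real"
  where "connection_coeff1 H p = partial2 H p / (H p)\<^sup>2"

definition connection_coeff2 :: "(complex \<Rightarrow> real) \<Rightarrow> complex \<Rightarrow> real"
  where "connection_coeff2 H p = - partial1 H p / (H p)\<^sup>2"

definition complex_curvature :: "(complex \<Rightarrow> complex) \<Rightarrow> complex \<Rightarrow> complex"
  where "complex_curvature f p =
    - (complex_of_real (connection_coeff1 (conformal_factor f) p)
       - \<i> * complex_of_real (connection_coeff2 (conformal_factor f) p))"

end

theory Submission
  imports Defs
begin

text \<open>
  Writing \<open>H = \<bar>f'\<bar>\<close>, the definition of the complex curvature says \<open>\<omega> = -\<i> (H\<^sub>1 - \<i> H\<^sub>2) / H\<^sup>2\<close>,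
  so \<open>\<omega>\<close> is a Wirtinger derivative of \<open>H = (f' cnj f')\<^bsup>1/2\<^esup>\<close> up to a factor. As \<open>cnj f'\<close> is
  antiholomorphic, only \<open>f'\<close> is differentiated, and the result is the closed form
  \<open>\<omega> = -\<i> f'' / (f' \<bar>f'\<bar>)\<close> of \<open>complex_curvature_holomorphic\<close>.

  For the inverse \<open>q\<close> of \<open>z\<close> one has \<open>q' = 1 / z'\<close> and \<open>q'' = - z'' / z'\<^sup>3\<close> at corresponding points
  (\<open>second_deriv_inverse\<close>). Substituting both in the closed form, the second derivative cancels from
  the quotient of the curvatures, which leaves \<open>- \<bar>z'\<bar>\<^sup>2 / z' = - cnj z'\<close>.
\<close>

lemma cmod_has_real_derivative:
  fixes \<gamma> :: "real \<Rightarrow> complex"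
  assumes "(\<gamma> has_vector_derivative d) (at t)" and "\<gamma> t \<noteq> 0"
  shows "((\<lambda>s. cmod (\<gamma> s)) has_real_derivative Re (cnj (\<gamma> t) * d) / cmod (\<gamma> t)) (at t)"
proof -
  have "((\<lambda>s. cmod (\<gamma> s)) has_derivative (\<lambda>h. (h *\<^sub>R d) \<bullet> sgn (\<gamma> t))) (at t)"
    by (rule has_derivative_compose[OF assms(1)[unfolded has_vector_derivative_def]
          has_derivative_norm[OF assms(2)]])
  moreover have "(\<lambda>h. (h *\<^sub>R d) \<bullet> sgn (\<gamma> t)) = (*) (Re (cnj (\<gamma> t) * d) / cmod (\<gamma> t))"
    by (auto simp: sgn_div_norm inner_complex_def algebra_simps divide_simps)
  ultimately show ?thesis
    by (simp add: has_field_derivative_def)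
qed

lemma partials_cmod_holomorphic:
  assumes "(g has_field_derivative g') (at p)" and "g p \<noteq> 0"
  shows "partial1 (\<lambda>w. cmod (g w)) p = Re (cnj (g p) * g') / cmod (g p)"
    and "partial2 (\<lambda>w. cmod (g w)) p = - Im (cnj (g p) * g') / cmod (g p)"
proof -
  have "((\<lambda>t. Complex t (Im p)) has_vector_derivative 1) (at (Re p))"
    unfolding Complex_eq by (auto intro!: derivative_eq_intros)
  from field_vector_diff_chain_at[OF this, of g g'] assms
  have "((\<lambda>t. g (Complex t (Im p))) has_vector_derivative g') (at (Re p))"
    by (simp add: o_def)
  from cmod_has_real_derivative[OF this] assms(2)
  show "partial1 (\<lambda>w. cmod (g w)) p = Re (cnj (g p) * g') / cmod (g p)"
    unfolding partial1_def by (intro DERIV_imp_deriv) simp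
  have "((\<lambda>t. Complex (Re p) t) has_vector_derivative \<i>) (at (Im p))"
    unfolding Complex_eq by (auto intro!: derivative_eq_intros)
  from field_vector_diff_chain_at[OF this, of g g'] assms
  have "((\<lambda>t. g (Complex (Re p) t)) has_vector_derivative \<i> * g') (at (Im p))"
    by (simp add: o_def)
  from cmod_has_real_derivative[OF this] assms(2)
  show "partial2 (\<lambda>w. cmod (g w)) p = - Im (cnj (g p) * g') / cmod (g p)"
    unfolding partial2_def by (intro DERIV_imp_deriv) (simp add: algebra_simps)
qed

text \<open>
  The two partial derivatives of \<open>\<bar>g\<bar>\<close>, where \<open>g = f'\<close>, are the real part and minus the imaginary
  part of \<open>cnj g g' / \<bar>g\<bar>\<close>, so the real combination in the definition of the curvature reassembles
  this complex number.
\<close>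

lemma complex_curvature_holomorphic:
  assumes "f holomorphic_on U" and "open U" and "p \<in> U" and nz: "deriv f p \<noteq> 0"
  shows "complex_curvature f p =
    - \<i> * deriv (deriv f) p / (deriv f p * complex_of_real (cmod (deriv f p)))"
proof -
  define g where "g = deriv f p"
  define g' where "g' = deriv (deriv f) p"
  have "(deriv f has_field_derivative g') (at p)"
    unfolding g'_def using assms holomorphic_deriv holomorphic_derivI by blast
  note partials = partials_cmod_holomorphic[OF this nz]
  have "g \<noteq> 0"
    using nz by (simp add: g_def)
  have "complex_curvature f p =
      - \<i> * complex_of_real (1 / cmod g ^ 3) *
        (complex_of_real (Re (cnj g * g')) + \<i> * complex_of_real (Im (cnj g * g')))"
    unfolding complex_curvature_def connection_coeff1_def connection_coeff2_def
      conformal_factor_def partials g_def[symmetric]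
    by (simp add: complex_eq_iff power3_eq_cube power2_eq_square)
  also have "\<dots> = - \<i> * complex_of_real (1 / cmod g ^ 3) * (cnj g * g')"
    by (simp only: complex_eq[symmetric])
  also have "\<dots> = - \<i> * g' / (g * complex_of_real (cmod g))"
  proof -
    have "complex_of_real (cmod g) ^ 3 = g * cnj g * complex_of_real (cmod g)"
      by (simp add: power3_eq_cube complex_norm_square[symmetric] power2_eq_square)
    then show ?thesis
      using \<open>g \<noteq> 0\<close> by (simp add: divide_simps)
  qed
  finally show ?thesis
    by (simp add: g_def g'_def)
qed

lemma inverse_of_conformal:
  assumes "f holomorphic_on U" and "open U" and inv: "\<forall>u\<in>U. q (f u) = u"
  shows "open (f ` U)" and "q holomorphic_on f ` U"
    and "\<And>u. u \<in> U \<Longrightarrow> deriv q (f u) = 1 / deriv f u"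
proof -
  have inj: "inj_on f U"
    using inv by (intro inj_on_inverseI) auto
  show op: "open (f ` U)"
    by (rule open_mapping_thm3[OF assms(1,2) inj])
  obtain r where r: "r holomorphic_on f ` U"
    "\<And>u. u \<in> U \<Longrightarrow> deriv f u * deriv r (f u) = 1" "\<And>u. u \<in> U \<Longrightarrow> r (f u) = u"
    using holomorphic_has_inverse[OF assms(1,2) inj] by metis
  have eq: "r w = q w" if "w \<in> f ` U" for w
    using that r(3) inv by auto
  show "q holomorphic_on f ` U"
    using r(1) eq by (rule holomorphic_transform)
  fix u assume u: "u \<in> U"
  have "deriv q (f u) = deriv r (f u)"
    using u by (intro complex_derivative_transform_within_open[OF \<open>q holomorphic_on f ` U\<close> r(1) op])
      (auto simp: eq)
  moreover have "deriv f u \<noteq> 0"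
    using r(2)[OF u] by auto
  ultimately show "deriv q (f u) = 1 / deriv f u"
    using r(2)[OF u] by (simp add: field_simps)
qed

text \<open>Differentiate \<open>q' (f u) = 1 / f' u\<close> in \<open>u\<close>.\<close>

lemma second_deriv_inverse:
  assumes "f holomorphic_on U" and "open U" and inv: "\<forall>u\<in>U. q (f u) = u"
    and "p \<in> U" and nz: "deriv f p \<noteq> 0"
  shows "deriv (deriv q) (f p) = - deriv (deriv f) p / deriv f p ^ 3"
proof -
  note q = inverse_of_conformal[OF assms(1,2) inv]
  have dq: "(deriv q has_field_derivative deriv (deriv q) (f p)) (at (f p))"
    using q(1,2) \<open>p \<in> U\<close> holomorphic_deriv holomorphic_derivI by blast
  have df: "(f has_field_derivative deriv f p) (at p)"
    using assms holomorphic_derivI by blast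
  have ddf: "(deriv f has_field_derivative deriv (deriv f) p) (at p)"
    using assms holomorphic_deriv holomorphic_derivI by blast
  have "((\<lambda>u. deriv q (f u)) has_field_derivative deriv (deriv q) (f p) * deriv f p) (at p)"
    by (rule DERIV_chain2[OF dq df])
  moreover have "((\<lambda>u. deriv q (f u)) has_field_derivative
      - deriv (deriv f) p / deriv f p ^ 2) (at p)"
  proof (rule has_field_derivative_transform_within_open[OF _ \<open>open U\<close> \<open>p \<in> U\<close>])
    show "((\<lambda>u. 1 / deriv f u) has_field_derivative - deriv (deriv f) p / deriv f p ^ 2) (at p)"
      using nz by (auto intro!: derivative_eq_intros ddf simp: power2_eq_square)
  qed (use q(3) in auto)
  ultimately have "deriv (deriv q) (f p) * deriv f p = - deriv (deriv f) p / deriv f p ^ 2"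
    by (rule DERIV_unique)
  then show ?thesis
    using nz by (simp add: field_simps power2_eq_square power3_eq_cube)
qed

theorem proposition1:
  fixes z q :: "complex \<Rightarrow> complex" and U V :: "complex set" and p :: complex
  assumes "conformal_transformation z U V"
    and "\<And>u. u \<in> U \<Longrightarrow> q (z u) = u"
    and "p \<in> U"
    and "complex_curvature z p \<noteq> 0"
  shows "deriv z p = - cnj (complex_curvature q (z p) / complex_curvature z p)"
proof -
  have z: "open U" "z holomorphic_on U" "deriv z p \<noteq> 0"
    using assms(1,3) by (auto simp: conformal_transformation_def)
  have inv: "\<forall>u\<in>U. q (z u) = u"
    using assms(2) by blast
  note q = inverse_of_conformal[OF z(2,1) inv]
  define a where "a = deriv z p"
  define b where "b = deriv (deriv z) p"
  have a: "a \<noteq> 0"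
    using z(3) by (simp add: a_def)
  have \<omega>: "complex_curvature z p = - \<i> * b / (a * complex_of_real (cmod a))"
    using complex_curvature_holomorphic[OF z(2,1) assms(3) z(3)] by (simp add: a_def b_def)
  then have b: "b \<noteq> 0"
    using assms(4) by auto
  have dq: "deriv q (z p) = 1 / a"
    using q(3)[OF assms(3)] by (simp add: a_def)
  have ddq: "deriv (deriv q) (z p) = - b / a ^ 3"
    using second_deriv_inverse[OF z(2,1) inv assms(3) z(3)] by (simp add: a_def b_def)
  have "complex_curvature q (z p) =
      - \<i> * (- b / a ^ 3) / (1 / a * complex_of_real (cmod (1 / a)))"
    using complex_curvature_holomorphic[OF q(2,1), of "z p"] assms(3) a by (simp add: dq ddq)
  also have "\<dots> = \<i> * b * complex_of_real (cmod a) / a ^ 2"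
    using a by (simp add: norm_divide field_simps power2_eq_square power3_eq_cube)
  finally have "complex_curvature q (z p) / complex_curvature z p =
      - (complex_of_real (cmod a) ^ 2) / a"
    unfolding \<omega> using a b by (simp add: field_simps power2_eq_square)
  also have "\<dots> = - cnj a"
    using a by (simp add: complex_norm_square flip: of_real_power)
  finally show ?thesis
    by (simp add: a_def)
qed

end
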